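(* Consider the ACC-embedded traffic flow model $$\begin{bmatrix}\rho\\ v\end{bmatrix}_t+\begin{bmatrix} v & \rho\\ 0 & v-\dfrac{k_v(\rho,v)}{\rho}\end{bmatrix}\begin{bmatrix}\rho\\ v\end{bmatrix}_x=\begin{bmatrix}0\\ \left(\dfrac1\rho-\tau v-L\right)k_s(\rho,v)\end{bmatrix},$$ with $\rho>0$ and $k_v(\rho,v)\ge 0$. The model is anisotropic: at every state $(\rho,v)$, every characteristic speed (eigenvalue of the coefficient matrix multiplying the $x$-derivative) is less than or equal to the vehicle speed $v$.
   Context: $\rho$ is traffic density and $v$ is speed. The constants $\tau$ and $L$ are the desired time headway and the standstill distance. The gains are, for constants $k_s,k_v$ (with the same letters used for the functions), a critical density $\rho_c$ and a free-flow speed $v_f$: $k_s(\rho,v)=0$ and $k_v(\rho,v)=0$ if $0<\rho\le\rho_c$ and $v=v_f$; otherwise $k_s(\rho,v)=k_s$ and $k_v(\rho,v)=k_v$. Anisotropic means that no disturbance propagates faster than the traffic, i.e. no characteristic speed exceeds $v$. *)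

theory Defs
  imports Complex_Main "Jordan_Normal_Form.Char_Poly"
begin

definition gain :: "real \<Rightarrow> real \<Rightarrow> real \<Rightarrow> real \<Rightarrow> real \<Rightarrow> real" where
  "gain \<rho>\<^sub>c v\<^sub>f k \<rho> v = (if 0 < \<rho> \<and> \<rho> \<le> \<rho>\<^sub>c \<and> v = v\<^sub>f then 0 else k)"

text \<open>A model stands for the quasilinear system \<open>U\<^sub>t + A(U) U\<^sub>x = S(U)\<close> in the unknown
  \<open>U = (\<rho>, v)\<close>, where \<open>U\<close> takes values in \<open>states\<close>, \<open>A\<close> is \<open>coeff\<close> and \<open>S\<close> is \<open>source\<close>.\<close>

record traffic_model =
  states :: "(real \<times> real) set"
  coeff :: "real \<Rightarrow> real \<Rightarrow> real mat"
  source :: "real \<Rightarrow> real \<Rightarrow> real vec"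

definition acc_model ::
    "real \<Rightarrow> real \<Rightarrow> (real \<Rightarrow> real \<Rightarrow> real) \<Rightarrow> (real \<Rightarrow> real \<Rightarrow> real) \<Rightarrow> traffic_model" where
  "acc_model \<tau> L k_s k_v =
    \<lparr>states = {(\<rho>, v). \<rho> > 0},
     coeff = (\<lambda>\<rho> v. mat_of_rows_list 2
       [[v, \<rho>],
        [0, v - k_v \<rho> v / \<rho>]]),
     source = (\<lambda>\<rho> v. vec_of_list [0, (1 / \<rho> - \<tau> * v - L) * k_s \<rho> v])\<rparr>"

text \<open>Eigenvalues are taken over the complex numbers, so that anisotropy cannot hold vacuously
  because the real coefficient matrix has no real eigenvalue; for a complex number, being at most
  the real speed \<open>v\<close> includes being real.\<close>

definition characteristic_speed :: "traffic_model \<Rightarrow> real \<Rightarrow> real \<Rightarrow> complex \<Rightarrow> bool" where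
  "characteristic_speed M \<rho> v c \<longleftrightarrow> eigenvalue (map_mat complex_of_real (coeff M \<rho> v)) c"

definition anisotropic :: "traffic_model \<Rightarrow> bool" where
  "anisotropic M \<longleftrightarrow>
    (\<forall>(\<rho>, v) \<in> states M. \<forall>c. characteristic_speed M \<rho> v c \<longrightarrow> c \<in> \<real> \<and> Re c \<le> v)"

end

theory Submission
  imports Defs
begin

text \<open>The coefficient matrix is upper triangular, so even over the complex numbers its
  eigenvalues lie among its real diagonal entries \<open>v\<close> and
  \<open>v - k_v \<rho> v / \<rho>\<close> (\<open>characteristic_speed_acc_model\<close>). With a
  nonnegative gain and \<rho> > 0, neither exceeds \<open>v\<close>.\<close>

text \<open>The characteristic polynomial splits into the factors X - a over the diagonal entries a,
  and in a field a product vanishes only if some factor does.\<close>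

lemma eigenvalue_upper_triangular:
  fixes A :: "'a :: field mat"
  assumes "A \<in> carrier_mat n n" "upper_triangular A" "eigenvalue A c"
  shows "c \<in> set (diag_mat A)"
proof -
  have "poly (\<Prod>a\<leftarrow>diag_mat A. [:- a, 1:]) c = 0"
    using eigenvalue_root_char_poly[OF assms(1)] assms(3)
    by (simp add: char_poly_upper_triangular[OF assms(1,2)])
  then show ?thesis
    by (auto simp: poly_prod_list prod_list_zero_iff)
qed

text \<open>One direction suffices: anisotropy bounds every eigenvalue but does not ask that both
  candidates occur.\<close>

lemma characteristic_speed_acc_model:
  assumes "characteristic_speed (acc_model \<tau> L k_s k_v) \<rho> v c"
  shows "c = complex_of_real v \<or> c = complex_of_real (v - k_v \<rho> v / \<rho>)"
proof -
  let ?A = "map_mat complex_of_real (mat_of_rows_list 2 [[v, \<rho>], [0, v - k_v \<rho> v / \<rho>]])"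
  have "c \<in> set (diag_mat ?A)"
  proof (rule eigenvalue_upper_triangular)
    show "?A \<in> carrier_mat 2 2"
      by (rule carrier_matI) (simp_all add: mat_of_rows_list_def)
    show "upper_triangular ?A"
      by (rule upper_triangularI) (auto simp: mat_of_rows_list_def less_Suc_eq)
    show "eigenvalue ?A c"
      using assms unfolding characteristic_speed_def acc_model_def by simp
  qed
  then show ?thesis
    by (auto simp: diag_mat_def mat_of_rows_list_def)
qed

theorem lemma2:
  fixes \<tau> L \<rho>\<^sub>c v\<^sub>f k\<^sub>s k\<^sub>v :: real
  assumes "\<And>\<rho> v. \<rho> > 0 \<Longrightarrow> gain \<rho>\<^sub>c v\<^sub>f k\<^sub>v \<rho> v \<ge> 0"
  shows "anisotropic (acc_model \<tau> L (gain \<rho>\<^sub>c v\<^sub>f k\<^sub>s) (gain \<rho>\<^sub>c v\<^sub>f k\<^sub>v))"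
proof -
  have "c \<in> \<real> \<and> Re c \<le> v"
    if "\<rho> > 0"
      "characteristic_speed (acc_model \<tau> L (gain \<rho>\<^sub>c v\<^sub>f k\<^sub>s) (gain \<rho>\<^sub>c v\<^sub>f k\<^sub>v)) \<rho> v c"
    for \<rho> v c
  proof -
    have "gain \<rho>\<^sub>c v\<^sub>f k\<^sub>v \<rho> v / \<rho> \<ge> 0"
      using assms \<open>\<rho> > 0\<close> by simp
    with characteristic_speed_acc_model[OF that(2)] show ?thesis
      \<comment> \<open>Keeping the second speed as a single embedded real makes its realness and
        its real part immediate.\<close>
      by (auto simp del: of_real_diff of_real_divide)
  qed
  moreover have "states (acc_model \<tau> L (gain \<rho>\<^sub>c v\<^sub>f k\<^sub>s) (gain \<rho>\<^sub>c v\<^sub>f k\<^sub>v)) = {(\<rho>, v). \<rho> > 0}"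
    by (simp add: acc_model_def)
  ultimately show ?thesis
    by (auto simp: anisotropic_def)
qed

end
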